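(* There exist a polynomial map $F:\mathbb{C}^4\to\mathbb{C}^2$ and a point $t_0\in\mathbb{C}^2$ such that: (1) $t_0$ is an interior point of $\operatorname{Im} F\setminus F(\operatorname{Sing}(F))$; (2) there is a neighbourhood of $t_0$ in $\mathbb{C}^2$ over which all the fibres $F^{-1}(t)$ are connected and pairwise diffeomorphic; (3) $t_0\in B(F)$, i.e. $t_0$ is a bifurcation value of $F$.
   Context: For a (complex) polynomial map $F:\mathbb{C}^m\to\mathbb{C}^p$ with $m\ge p\ge 1$, $\operatorname{Sing}(F)$ denotes the set of points of $\mathbb{C}^m$ at which $F$ is not a submersion, and $\operatorname{Im} F$ is the image of $F$. Diffeomorphic means $\mathcal{C}^\infty$ diffeomorphic as real manifolds. $F$ is called (locally) $\mathcal{C}^\infty$ trivial at $t_0\in\mathbb{C}^p$ if there is a neighbourhood $D$ of $t_0$ such that the restriction $F_|:F^{-1}(D)\to D$ is a $\mathcal{C}^\infty$ trivial fibration, i.e. there is a $\mathcal{C}^\infty$ diffeomorphism $\Phi:F^{-1}(D)\to F^{-1}(t_0)\times D$ with $p_2\circ\Phi=F_|$, where $p_2$ is the projection to $D$. A point $t_0$ is a bifurcation value of $F$ if $F$ is not $\mathcal{C}^\infty$ trivial at $t_0$; the set of bifurcation values is denoted $B(F)$. *)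

theory Defs
  imports "HOL-Analysis.Analysis"
begin

text \<open>Finite sums of monomials; the exponent vectors \<open>a k\<close> need not be distinct.\<close>

definition complex_polynomial :: "(complex ^ 'm \<Rightarrow> complex) \<Rightarrow> bool" where
  "complex_polynomial P \<longleftrightarrow>
     (\<exists>(N::nat) (c :: nat \<Rightarrow> complex) (a :: nat \<Rightarrow> 'm \<Rightarrow> nat).
        \<forall>x. P x = (\<Sum>k<N. c k * (\<Prod>i\<in>UNIV. (x $ i) ^ a k i)))"

definition polynomial_map :: "(complex ^ 'm \<Rightarrow> complex ^ 'p) \<Rightarrow> bool" where
  "polynomial_map F \<longleftrightarrow> (\<forall>j. complex_polynomial (\<lambda>x. F x $ j))"

text \<open>All derivatives are real Frechet derivatives, also on complex spaces. On an open set \<open>U\<close>,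
  \<open>C_k k f U\<close> says that \<open>f\<close> has continuous iterated directional derivatives up to order \<open>k\<close>.\<close>

primrec C_k :: "nat \<Rightarrow> ('a::euclidean_space \<Rightarrow> 'b::euclidean_space) \<Rightarrow> 'a set \<Rightarrow> bool" where
  "C_k 0 f U \<longleftrightarrow> continuous_on U f"
| "C_k (Suc k) f U \<longleftrightarrow>
     (\<forall>x\<in>U. f differentiable (at x)) \<and>
     (\<forall>v. C_k k (\<lambda>x. frechet_derivative f (at x) v) U)"

text \<open>Smoothness on an arbitrary subset is local extendability to a \<open>C\<^sup>\<infinity>\<close> map of the ambient
  space. For embedded submanifolds, such as regular fibres and their products with open sets,
  this is smoothness with respect to the induced manifold structure.\<close>

definition smooth_map_on ::
    "'a::euclidean_space set \<Rightarrow> ('a \<Rightarrow> 'b::euclidean_space) \<Rightarrow> bool" where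
  "smooth_map_on A f \<longleftrightarrow>
     (\<forall>x\<in>A. \<exists>U g. open U \<and> x \<in> U \<and> (\<forall>k. C_k k g U) \<and> (\<forall>y\<in>U \<inter> A. g y = f y))"

definition diffeomorphism ::
    "'a::euclidean_space set \<Rightarrow> 'b::euclidean_space set \<Rightarrow> ('a \<Rightarrow> 'b) \<Rightarrow> bool" where
  "diffeomorphism A B f \<longleftrightarrow>
     bij_betw f A B \<and> smooth_map_on A f \<and> smooth_map_on B (inv_into A f)"

definition diffeomorphic ::
    "'a::euclidean_space set \<Rightarrow> 'b::euclidean_space set \<Rightarrow> bool" where
  "diffeomorphic A B \<longleftrightarrow> (\<exists>f. diffeomorphism A B f)"

text \<open>For a holomorphic map the real derivative is the complex one regarded as a real-linear map,
  so its surjectivity is the submersion condition in either reading.\<close>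

definition submersion_at ::
    "('a::euclidean_space \<Rightarrow> 'b::euclidean_space) \<Rightarrow> 'a \<Rightarrow> bool" where
  "submersion_at F x \<longleftrightarrow> (\<exists>F'. (F has_derivative F') (at x) \<and> surj F')"

definition Sing :: "('a::euclidean_space \<Rightarrow> 'b::euclidean_space) \<Rightarrow> 'a set" where
  "Sing F = {x. \<not> submersion_at F x}"

text \<open>Since triviality over a neighbourhood restricts to smaller ones, the neighbourhood may be
  taken open.\<close>

definition smoothly_trivial_at ::
    "('a::euclidean_space \<Rightarrow> 'b::euclidean_space) \<Rightarrow> 'b \<Rightarrow> bool" where
  "smoothly_trivial_at F t \<longleftrightarrow>
     (\<exists>D \<Phi>. open D \<and> t \<in> D \<and>
        diffeomorphism (F -` D) ((F -` {t}) \<times> D) \<Phi> \<and>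
        (\<forall>x \<in> F -` D. snd (\<Phi> x) = F x))"

definition bifurcation_values ::
    "('a::euclidean_space \<Rightarrow> 'b::euclidean_space) \<Rightarrow> 'b set" where
  "bifurcation_values F = {t. \<not> smoothly_trivial_at F t}"

end

theory Submission
  imports Defs
begin

text \<open>The example is \<open>F(s, x, y, z) = (s, (1 - s x) (s z + x y))\<close> at \<open>t\<^sub>0 = (0, 1)\<close>. Over \<open>(s, \<tau>)\<close>
  with \<open>\<tau> \<noteq> 0\<close> the fibre is \<open>\<complex>\<^sup>* \<times> \<complex>\<close>, but the \<open>\<complex>\<^sup>*\<close> factor has two different origins: for \<open>s = 0\<close>
  the fibre is \<open>x y = \<tau>\<close> with coordinates \<open>(x, z)\<close>, and for \<open>s \<noteq> 0\<close> the coordinates are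
  \<open>(1 - s x, y)\<close>. The loop \<open>x = e\<^bsup>i\<theta>\<^esup>\<close> in the fibre over \<open>t\<^sub>0\<close> therefore contracts in nearby fibres, where
  \<open>x = 0\<close> is allowed, while the generating loop around \<open>x = 1/s\<close> escapes to infinity as \<open>s \<rightarrow> 0\<close>.
  A local trivialisation would carry a disc filling this loop in a tube back into the fibre over
  \<open>t\<^sub>0\<close>; as \<open>x \<noteq> 0\<close> there, the disc would retract onto its boundary circle.\<close>

section \<open>Calculus of \<open>C_k\<close> maps on open sets\<close>

lemma C_k_cong:
  fixes f g :: "'a::euclidean_space \<Rightarrow> 'b::euclidean_space"
  assumes "open U" "\<And>x. x \<in> U \<Longrightarrow> f x = g x" "C_k k f U"
  shows "C_k k g U"
  using assms(2,3)
proof (induction k arbitrary: f g)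
  case 0
  then show ?case
    by (metis C_k.simps(1) continuous_on_cong)
next
  case (Suc k)
  have der: "(g has_derivative frechet_derivative f (at x)) (at x)" if "x \<in> U" for x
  proof (rule has_derivative_transform_within_open[OF _ assms(1) that Suc.prems(1)])
    show "(f has_derivative frechet_derivative f (at x)) (at x)"
      using Suc.prems(2) that by (simp flip: frechet_derivative_works)
  qed
  then have "g differentiable (at x)" if "x \<in> U" for x
    using that unfolding differentiable_def by blast
  moreover have "C_k k (\<lambda>x. frechet_derivative g (at x) v) U" for v
    using Suc.prems(2) frechet_derivative_at[OF der]
    by (subst Suc.IH[of "\<lambda>x. frechet_derivative f (at x) v"]) auto
  ultimately show ?case by simp
qed

text \<open>By uniqueness of derivatives, any explicit formula \<open>f'\<close> may replace
  \<open>frechet_derivative\<close> on an open set. The rules below use this in their induction on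
  \<open>k\<close>.\<close>

lemma C_k_SucI:
  assumes "open U" "\<And>x. x \<in> U \<Longrightarrow> (f has_derivative f' x) (at x)"
    and "\<And>v. C_k k (\<lambda>x. f' x v) U"
  shows "C_k (Suc k) f U"
proof -
  have "C_k k (\<lambda>x. frechet_derivative f (at x) v) U" for v
    by (rule C_k_cong[OF assms(1) _ assms(3)[of v]]) (metis assms(2) frechet_derivative_at)
  moreover have "f differentiable (at x)" if "x \<in> U" for x
    using assms(2)[OF that] unfolding differentiable_def by blast
  ultimately show ?thesis by simp
qed

text \<open>The recursion only bottoms out in continuity, so the base case is that differentiability
  implies continuity. Needed for products and inverses, whose derivatives still contain the
  undifferentiated functions.\<close>

lemma C_k_Suc_imp: "C_k (Suc k) f U \<Longrightarrow> C_k k f U"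
proof (induction k arbitrary: f)
  case 0
  then have "\<forall>x\<in>U. f differentiable (at x)"
    unfolding C_k.simps by blast
  then have "continuous_on U f"
    by (intro continuous_at_imp_continuous_on ballI differentiable_imp_continuous_within) blast
  then show ?case
    unfolding C_k.simps .
next
  case (Suc k)
  have "f differentiable (at x)" if "x \<in> U" for x
    using Suc.prems that by simp
  moreover have "C_k k (\<lambda>x. frechet_derivative f (at x) v) U" for v
    by (rule Suc.IH) (use Suc.prems in \<open>unfold C_k.simps(2)[of "Suc k"], blast\<close>)
  ultimately show ?case by simp
qed

lemma C_k_const: "open U \<Longrightarrow> C_k k (\<lambda>x. c) U"
proof (induction k arbitrary: c)
  case (Suc k)
  then show ?case
    by (intro C_k_SucI[where f' = "\<lambda>x v. 0"]) auto
qed auto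

lemma C_k_bounded_linear:
  assumes "open U" "bounded_linear L" "C_k k f U"
  shows "C_k k (\<lambda>x. L (f x)) U"
  using assms(3)
proof (induction k arbitrary: f)
  case 0
  then show ?case
    using assms(2) by (simp add: bounded_linear.continuous_on)
next
  case (Suc k)
  show ?case
  proof (rule C_k_SucI[OF assms(1)])
    show "((\<lambda>x. L (f x)) has_derivative (\<lambda>v. L (frechet_derivative f (at x) v))) (at x)"
      if "x \<in> U" for x
      using Suc.prems that
      by (intro bounded_linear.has_derivative[OF assms(2)])
         (auto simp flip: frechet_derivative_works)
  qed (use Suc in auto)
qed

lemma C_k_id: "open U \<Longrightarrow> C_k k (\<lambda>x. x) U"
  by (cases k) (auto intro: C_k_SucI[where f' = "\<lambda>x v. v"] C_k_const)

lemma C_k_add: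
  assumes "open U" "C_k k f U" "C_k k g U"
  shows "C_k k (\<lambda>x. f x + g x) U"
  using assms(2,3)
proof (induction k arbitrary: f g)
  case 0
  then show ?case by (simp add: continuous_on_add)
next
  case (Suc k)
  show ?case
  proof (rule C_k_SucI[OF assms(1)])
    show "((\<lambda>x. f x + g x) has_derivative
        (\<lambda>v. frechet_derivative f (at x) v + frechet_derivative g (at x) v)) (at x)"
      if "x \<in> U" for x
      using Suc.prems that
      by (intro has_derivative_add) (auto simp flip: frechet_derivative_works)
  qed (use Suc in auto)
qed

lemma C_k_mult:
  fixes f g :: "'a::euclidean_space \<Rightarrow> 'b::{euclidean_space, real_normed_algebra}"
  assumes "open U" "C_k k f U" "C_k k g U"
  shows "C_k k (\<lambda>x. f x * g x) U"
  using assms(2,3)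
proof (induction k arbitrary: f g)
  case 0
  then show ?case by (simp add: continuous_on_mult)
next
  case (Suc k)
  show ?case
  proof (rule C_k_SucI[OF assms(1)])
    show "((\<lambda>x. f x * g x) has_derivative
        (\<lambda>v. f x * frechet_derivative g (at x) v + frechet_derivative f (at x) v * g x)) (at x)"
      if "x \<in> U" for x
      using Suc.prems that
      by (intro has_derivative_mult) (auto simp flip: frechet_derivative_works)
    show "C_k k (\<lambda>x. f x * frechet_derivative g (at x) v + frechet_derivative f (at x) v * g x) U"
      for v
      using Suc.prems C_k_Suc_imp[OF Suc.prems(1)] C_k_Suc_imp[OF Suc.prems(2)]
      by (intro C_k_add assms(1) Suc.IH) auto
  qed
qed

text \<open>The derivative of \<open>inverse (f x)\<close> contains \<open>inverse (f x)\<close>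
  itself, which the induction hypothesis covers at order \<open>k\<close>.\<close>

lemma C_k_inverse:
  fixes f :: "'a::euclidean_space \<Rightarrow> 'b::{euclidean_space, real_normed_div_algebra}"
  assumes "open U" "C_k k f U" "\<And>x. x \<in> U \<Longrightarrow> f x \<noteq> 0"
  shows "C_k k (\<lambda>x. inverse (f x)) U"
  using assms(2)
proof (induction k)
  case 0
  then show ?case using assms(3) by (simp add: continuous_on_inverse)
next
  case (Suc k)
  show ?case
  proof (rule C_k_SucI[OF assms(1)])
    show "((\<lambda>x. inverse (f x)) has_derivative
        (\<lambda>v. - (inverse (f x) * frechet_derivative f (at x) v * inverse (f x)))) (at x)"
      if "x \<in> U" for x
      using Suc.prems that assms(3)
      by (intro Deriv.has_derivative_inverse) (auto simp flip: frechet_derivative_works)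
    show "C_k k (\<lambda>x. - (inverse (f x) * frechet_derivative f (at x) v * inverse (f x))) U" for v
      using Suc.prems Suc.IH C_k_Suc_imp[OF Suc.prems]
      by (intro C_k_bounded_linear[OF assms(1) bounded_linear_minus[OF bounded_linear_ident]]
          C_k_mult assms(1)) auto
  qed
qed

lemma C_k_uminus: "open U \<Longrightarrow> C_k k f U \<Longrightarrow> C_k k (\<lambda>x. - f x) U"
  by (rule C_k_bounded_linear[OF _ bounded_linear_minus[OF bounded_linear_ident]])

lemma C_k_diff: "open U \<Longrightarrow> C_k k f U \<Longrightarrow> C_k k g U \<Longrightarrow> C_k k (\<lambda>x. f x - g x) U"
  using C_k_add[of U k f "\<lambda>x. - g x"] by (simp add: C_k_uminus)

lemma C_k_divide:
  fixes f g :: "'a::euclidean_space \<Rightarrow> 'b::{euclidean_space, real_normed_field}"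
  assumes "open U" "C_k k f U" "C_k k g U" "\<And>x. x \<in> U \<Longrightarrow> g x \<noteq> 0"
  shows "C_k k (\<lambda>x. f x / g x) U"
  unfolding divide_inverse using assms by (intro C_k_mult C_k_inverse)

lemma C_k_sum:
  assumes "open U" "finite I" "\<And>i. i \<in> I \<Longrightarrow> C_k k (f i) U"
  shows "C_k k (\<lambda>x. \<Sum>i\<in>I. f i x) U"
  using assms(2,3) by (induction I rule: finite_induct) (auto intro: C_k_const C_k_add assms(1))

lemma C_k_vec_nth: "open U \<Longrightarrow> C_k k f U \<Longrightarrow> C_k k (\<lambda>x. f x $ i) U"
  by (rule C_k_bounded_linear[OF _ bounded_linear_vec_nth])

lemma C_k_vec:
  fixes f :: "'a::euclidean_space \<Rightarrow> 'b::euclidean_space ^ 'n"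
  assumes "open U" "\<And>i. C_k k (\<lambda>x. f x $ i) U"
  shows "C_k k f U"
proof -
  have eq: "f x = (\<Sum>i\<in>UNIV. axis i (f x $ i))" for x
    by (simp add: vec_eq_iff axis_def if_distrib sum.delta cong: if_cong)
  have "bounded_linear (axis i :: 'b \<Rightarrow> 'b ^ 'n)" for i
    by (intro linear_conv_bounded_linear[THEN iffD1] linearI)
       (auto simp: vec_eq_iff axis_def)
  then have "C_k k (\<lambda>x. \<Sum>i\<in>UNIV. axis i (f x $ i)) U"
    by (intro C_k_sum C_k_bounded_linear[where L = "axis _"] assms) auto
  then show ?thesis
    using eq by (metis (no_types, lifting) C_k_cong[OF assms(1)])
qed

lemmas C_k_intros = C_k_const C_k_id C_k_add C_k_diff C_k_mult C_k_divide C_k_vec_nth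

section \<open>Smooth maps on arbitrary subsets and diffeomorphisms\<close>

lemma smooth_map_onI:
  assumes "open U" "A \<subseteq> U" "\<And>k. C_k k f U"
  shows "smooth_map_on A f"
  unfolding smooth_map_on_def using assms by blast

text \<open>Near each point of \<open>A\<close>, the map agrees on \<open>A\<close> with a
  continuous local extension. The obstruction argument uses only this topological consequence of
  smooth triviality.\<close>

lemma smooth_map_on_imp_continuous_on:
  assumes "smooth_map_on A f"
  shows "continuous_on A f"
  unfolding continuous_on_eq_continuous_within
proof
  fix x assume "x \<in> A"
  then obtain U g where U: "open U" "x \<in> U" "C_k 0 g U" "\<forall>y\<in>U \<inter> A. g y = f y"
    using assms unfolding smooth_map_on_def by blast
  then have g: "(g \<longlongrightarrow> g x) (at x within A)"
    by (simp add: continuous_on_eq_continuous_at continuous_at_imp_continuous_at_within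
        flip: continuous_within)
  have "\<forall>\<^sub>F y in at x within A. g y = f y"
    using U unfolding eventually_at_topological by blast
  then have "(f \<longlongrightarrow> g x) (at x within A)"
    using g by (rule Lim_transform_eventually[rotated])
  then show "continuous (at x within A) f"
    using U \<open>x \<in> A\<close> by (simp add: continuous_within)
qed

lemma diffeomorphismI:
  assumes "\<And>x. x \<in> A \<Longrightarrow> f x \<in> B" "\<And>y. y \<in> B \<Longrightarrow> g y \<in> A"
    and "\<And>x. x \<in> A \<Longrightarrow> g (f x) = x" "\<And>y. y \<in> B \<Longrightarrow> f (g y) = y"
    and "smooth_map_on A f" "smooth_map_on B g"
  shows "diffeomorphism A B f"
proof -
  have bij: "bij_betw f A B"
    by (rule bij_betw_byWitness[where f' = g]) (use assms in auto)
  have "inv_into A f y = g y" if "y \<in> B" for y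
    using that assms bij by (metis bij_betw_inv_into_left)
  then have "smooth_map_on B (inv_into A f)"
    using assms(6) unfolding smooth_map_on_def by (metis IntD2)
  then show ?thesis
    using bij assms(5) by (simp add: diffeomorphism_def)
qed

section \<open>The polynomial map and its submersion points\<close>

lemma vector_4:
  "(vector [a,b,c,d] :: 'a::zero^4) $ 1 = a"
  "(vector [a,b,c,d] :: 'a::zero^4) $ 2 = b"
  "(vector [a,b,c,d] :: 'a::zero^4) $ 3 = c"
  "(vector [a,b,c,d] :: 'a::zero^4) $ 4 = d"
  unfolding vector_def by simp_all

lemma prod_4: "prod f (UNIV :: 4 set) = f 1 * f 2 * f 3 * f 4"
  unfolding UNIV_4 by (simp add: ac_simps)

definition F :: "complex ^ 4 \<Rightarrow> complex ^ 2" where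
  "F p = vector [p $ 1, (1 - p $ 1 * p $ 2) * (p $ 1 * p $ 4 + p $ 2 * p $ 3)]"

lemma F_nth [simp]:
  "F p $ 1 = p $ 1"
  "F p $ 2 = (1 - p $ 1 * p $ 2) * (p $ 1 * p $ 4 + p $ 2 * p $ 3)"
  by (simp_all add: F_def)

lemma F_eq_iff:
  "F p = t \<longleftrightarrow> p $ 1 = t $ 1 \<and> (1 - t $ 1 * p $ 2) * (t $ 1 * p $ 4 + p $ 2 * p $ 3) = t $ 2"
  by (auto simp: vec_eq_iff forall_2)

lemma polynomial_map_F: "polynomial_map F"
proof -
  have "complex_polynomial (\<lambda>p. F p $ 1)"
    unfolding complex_polynomial_def
    by (rule exI[of _ 1], rule exI[of _ "\<lambda>_. 1"],
        rule exI[of _ "\<lambda>_. ($) (vector [1,0,0,0] :: nat ^ 4)"])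
       (simp add: prod_4 vector_4)
  \<comment> \<open>Expanded, the second component is \<open>s z + x y - s^2 x z - s x^2 y\<close>,
    which gives the four coefficients and exponent vectors.\<close>
  moreover have "complex_polynomial (\<lambda>p. F p $ 2)"
    unfolding complex_polynomial_def
    by (rule exI[of _ 4], rule exI[of _ "\<lambda>k. [1, 1, - 1, - 1] ! k"],
        rule exI[of _ "\<lambda>k. ($) ([vector [1,0,0,1], vector [0,1,1,0],
          vector [2,1,0,1], vector [1,2,1,0] :: nat ^ 4] ! k)"])
       (simp add: prod_4 vector_4 lessThan_nat_numeral lessThan_Suc power2_eq_square
          ring_distribs mult_ac)
  ultimately show ?thesis
    by (simp add: polynomial_map_def forall_2)
qed

text \<open>If the second component is nonzero, then \<open>1 - s x\<close> is nonzero and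
  \<open>s\<close>, \<open>x\<close> do not both vanish. Hence its partial derivative in
  \<open>y\<close> or in \<open>z\<close> is nonzero, while the first component is the coordinate
  \<open>s\<close>.\<close>

lemma submersion_at_F:
  assumes "F p $ 2 \<noteq> 0"
  shows "submersion_at F p"
proof -
  define s x y z where "s = p $ 1" and "x = p $ 2" and "y = p $ 3" and "z = p $ 4"
  define a where "a = 1 - s * x"
  define L where "L v = (a * (s * v $ 4 + v $ 1 * z + (x * v $ 3 + v $ 2 * y))
      + - (s * v $ 2 + v $ 1 * x) * (s * z + x * y))" for v :: "complex ^ 4"
  define F' where "F' v = (vector [v $ 1, L v] :: complex ^ 2)" for v
  have nz: "a \<noteq> 0" "s \<noteq> 0 \<or> x \<noteq> 0"
    using assms by (auto simp: a_def s_def x_def)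
  have vec2: "(vector [b, c] :: complex ^ 2) = axis 1 b + axis 2 c" for b c
    by (simp add: vec_eq_iff forall_2 axis_def)
  have ax: "bounded_linear (axis i :: complex \<Rightarrow> complex ^ 2)" for i
    by (intro linear_conv_bounded_linear[THEN iffD1] linearI)
       (auto simp: vec_eq_iff axis_def)
  have "(F has_derivative F') (at p)"
    unfolding F_def[abs_def] F'_def[abs_def] vec2 L_def a_def s_def x_def y_def z_def
    by (auto intro!: derivative_eq_intros bounded_linear.has_derivative[OF ax]
        bounded_linear.has_derivative[OF bounded_linear_vec_nth] simp: algebra_simps)
  moreover have "surj F'"
  proof -
    have "\<exists>v. F' v = w" for w
    proof -
      \<comment> \<open>With \<open>v $ 1 = w $ 1\<close> and \<open>v $ 2 = 0\<close>,
        \<open>r\<close> is what the \<open>y\<close> and \<open>z\<close> directions must still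
        contribute. The \<open>z\<close> direction does it if \<open>s\<close> is nonzero, the
        \<open>y\<close> direction otherwise.\<close>
      define r where "r = w $ 2 - w $ 1 * (a * z - x * (s * z + x * y))"
      define c where "c = (if s = 0 then r / (a * x) else 0)"
      define d where "d = (if s = 0 then 0 else r / (a * s))"
      have "a * (s * d + x * c) = r"
        using nz by (auto simp: c_def d_def)
      then have "F' (vector [w $ 1, 0, c, d]) = w"
        by (simp add: F'_def L_def vector_4 vec_eq_iff forall_2 r_def algebra_simps)
      then show ?thesis ..
    qed
    then show ?thesis
      by (metis surj_def)
  qed
  ultimately show ?thesis
    unfolding submersion_at_def by blast
qed

section \<open>Global coordinates \<open>(u, v)\<close> on the fibres\<close>

definition fibre_point :: "complex ^ 2 \<Rightarrow> complex \<Rightarrow> complex \<Rightarrow> complex ^ 4" where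
  "fibre_point t u v =
     (if t $ 1 = 0 then vector [0, u, t $ 2 / u, v]
      else vector [t $ 1, (1 - u) / t $ 1, v, (t $ 2 / u - (1 - u) / t $ 1 * v) / t $ 1])"

definition coord_u :: "complex ^ 2 \<Rightarrow> complex ^ 4 \<Rightarrow> complex" where
  "coord_u t p = (if t $ 1 = 0 then p $ 2 else 1 - t $ 1 * p $ 2)"

definition coord_v :: "complex ^ 2 \<Rightarrow> complex ^ 4 \<Rightarrow> complex" where
  "coord_v t p = (if t $ 1 = 0 then p $ 4 else p $ 3)"

lemma F_fibre_point: "u \<noteq> 0 \<Longrightarrow> F (fibre_point t u v) = t"
  by (auto simp: F_eq_iff fibre_point_def vector_4)

lemma coord_fibre_point [simp]:
  "coord_u t (fibre_point t u v) = u"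
  "coord_v t (fibre_point t u v) = v"
  by (auto simp: coord_u_def coord_v_def fibre_point_def vector_4)

lemma coord_u_nonzero: "F p = t \<Longrightarrow> t $ 2 \<noteq> 0 \<Longrightarrow> coord_u t p \<noteq> 0"
  by (auto simp: F_eq_iff coord_u_def)

text \<open>For \<open>t $ 1 = 0\<close> the fibre equation \<open>x y = t $ 2\<close> determines
  \<open>y\<close> from \<open>x\<close>. Otherwise \<open>u = 1 - s x\<close> determines
  \<open>x\<close>, and dividing the equation by \<open>u\<close> leaves one that is linear in
  \<open>z\<close> with coefficient \<open>s\<close>.\<close>

lemma fibre_point_coord:
  assumes "F p = t" "t $ 2 \<noteq> 0"
  shows "fibre_point t (coord_u t p) (coord_v t p) = p"
proof (cases "t $ 1 = 0")
  case True
  then have "p $ 1 = 0" "p $ 2 * p $ 3 = t $ 2" "p $ 2 \<noteq> 0"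
    using assms by (auto simp: F_eq_iff)
  then show ?thesis
    using True
    by (auto simp: coord_u_def coord_v_def fibre_point_def vec_eq_iff forall_4 vector_4 field_simps)
next
  case False
  have "1 - t $ 1 * p $ 2 \<noteq> 0"
    using coord_u_nonzero[OF assms] False by (simp add: coord_u_def)
  moreover have "p $ 1 = t $ 1" "(1 - t $ 1 * p $ 2) * (t $ 1 * p $ 4 + p $ 2 * p $ 3) = t $ 2"
    using assms by (simp_all add: F_eq_iff)
  ultimately have "p $ 1 = t $ 1" "t $ 2 / (1 - t $ 1 * p $ 2) = t $ 1 * p $ 4 + p $ 2 * p $ 3"
    by (simp, metis nonzero_mult_div_cancel_left)
  then show ?thesis
    using False
    by (simp add: coord_u_def coord_v_def fibre_point_def vec_eq_iff forall_4 vector_4)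
qed

text \<open>Since \<open>t\<close> is fixed, only one branch of the definition is in play, and the
  only varying denominator is \<open>f x\<close>.\<close>

lemma C_k_fibre_point:
  assumes "open U" "C_k k f U" "C_k k g U" "\<And>x. x \<in> U \<Longrightarrow> f x \<noteq> 0"
  shows "C_k k (\<lambda>x. fibre_point t (f x) (g x)) U"
proof (rule C_k_vec[OF assms(1)])
  fix i :: 4
  show "C_k k (\<lambda>x. fibre_point t (f x) (g x) $ i) U"
    using exhaust_4[of i] assms
    by (cases "t $ 1 = 0"; elim disjE; simp add: fibre_point_def vector_4; intro C_k_intros; simp)
qed

lemma C_k_coord:
  assumes "open U"
  shows "C_k k (coord_u t) U" "C_k k (coord_v t) U"
proof -
  show "C_k k (coord_u t) U"
    unfolding coord_u_def[abs_def]
    by (cases "t $ 1 = 0"; simp; intro C_k_intros assms)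
  show "C_k k (coord_v t) U"
    unfolding coord_v_def[abs_def]
    by (cases "t $ 1 = 0"; simp; intro C_k_intros assms)
qed

text \<open>The formula is smooth on the open set where \<open>coord_u s\<close> is nonzero, and
  this set contains the whole fibre.\<close>

lemma smooth_transition:
  assumes "s $ 2 \<noteq> 0"
  shows "smooth_map_on (F -` {s}) (\<lambda>p. fibre_point t (coord_u s p) (coord_v s p))"
proof -
  let ?U = "{p. coord_u s p \<noteq> 0}"
  have "continuous_on UNIV (coord_u s)"
    using C_k_coord(1)[of UNIV 0] by simp
  then have "open ?U"
    by (simp add: open_Collect_neq continuous_on_const)
  then show ?thesis
    using coord_u_nonzero assms
    by (intro smooth_map_onI[of ?U] C_k_fibre_point C_k_coord) auto
qed

text \<open>Matching points with equal coordinates \<open>(u, v)\<close> works in both directions,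
  so exchanging \<open>s\<close> and \<open>t\<close> gives the inverse.\<close>

lemma diffeomorphic_fibres:
  assumes "s $ 2 \<noteq> 0" "t $ 2 \<noteq> 0"
  shows "diffeomorphic (F -` {s}) (F -` {t})"
  unfolding diffeomorphic_def
proof
  show "diffeomorphism (F -` {s}) (F -` {t}) (\<lambda>p. fibre_point t (coord_u s p) (coord_v s p))"
    by (rule diffeomorphismI[where g = "\<lambda>p. fibre_point s (coord_u t p) (coord_v t p)"])
       (use assms in \<open>auto simp: F_fibre_point coord_u_nonzero fibre_point_coord
          intro: smooth_transition\<close>)
qed

text \<open>The fibre is a continuous image of the product of the punctured plane and the
  plane.\<close>

lemma connected_fibre:
  assumes "t $ 2 \<noteq> 0"
  shows "connected (F -` {t})"
proof -
  let ?M = "(- {0 :: complex}) \<times> (UNIV :: complex set)"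
  have "F -` {t} = (\<lambda>w. fibre_point t (fst w) (snd w)) ` ?M"
  proof (intro subset_antisym subsetI)
    fix p assume "p \<in> F -` {t}"
    then show "p \<in> (\<lambda>w. fibre_point t (fst w) (snd w)) ` ?M"
      using fibre_point_coord coord_u_nonzero assms
      by (intro image_eqI[of _ _ "(coord_u t p, coord_v t p)"]) auto
  qed (use F_fibre_point in fastforce)
  moreover have "connected ?M"
    by (intro connected_Times connected_punctured_universe) auto
  moreover have "continuous_on ?M (\<lambda>w. fibre_point t (fst w) (snd w))"
  proof -
    have "open ?M"
      by (intro open_Times) auto
    then have "C_k 0 (\<lambda>w. fibre_point t (fst w) (snd w)) ?M"
      by (intro C_k_fibre_point C_k_bounded_linear[OF _ bounded_linear_fst C_k_id]
          C_k_bounded_linear[OF _ bounded_linear_snd C_k_id]) auto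
    then show ?thesis by simp
  qed
  ultimately show ?thesis
    by (metis connected_continuous_image)
qed

section \<open>The topological obstruction to triviality\<close>

lemma not_smoothly_trivial_at_F:
  fixes t0 :: "complex ^ 2"
  defines "t0 \<equiv> vector [0, 1]"
  shows "\<not> smoothly_trivial_at F t0"
proof
  assume "smoothly_trivial_at F t0"
  then obtain D \<Phi> where D: "open D" "t0 \<in> D"
    and diff: "diffeomorphism (F -` D) ((F -` {t0}) \<times> D) \<Phi>"
    and proj: "\<And>p. p \<in> F -` D \<Longrightarrow> snd (\<Phi> p) = F p"
    unfolding smoothly_trivial_at_def by blast
  define \<Psi> where "\<Psi> = inv_into (F -` D) \<Phi>"
  have bij: "bij_betw \<Phi> (F -` D) ((F -` {t0}) \<times> D)"
    and cont\<Phi>: "continuous_on (F -` D) \<Phi>"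
    and cont\<Psi>: "continuous_on ((F -` {t0}) \<times> D) \<Psi>"
    using diff unfolding diffeomorphism_def \<Psi>_def
    by (auto intro: smooth_map_on_imp_continuous_on)
  obtain e where e: "e > 0" "\<And>t. dist t t0 < e \<Longrightarrow> t \<in> D"
    using D open_dist by blast
  \<comment> \<open>\<open>r < e\<close> keeps the disc over \<open>D\<close>; \<open>r < 1\<close>
    keeps \<open>1 - s x * x\<close> away from zero.\<close>
  define r where "r = min (e / 2) (1 / 2)"
  have r: "0 < r" "r < e" "r < 1"
    using e by (auto simp: r_def)
  \<comment> \<open>The base parameter is \<open>r\<close> at the centre of the disc and vanishes on
    the boundary circle, which therefore lies over \<open>t0\<close>.\<close>
  define s where "s x = complex_of_real (r * (1 - cmod x))" for x
  txt \<open>A disc in the tube, with second component constantly 1, that fills the loop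
    \<open>x \<mapsto> (0, x, cnj x, 2 / r)\<close> of the fibre over \<open>t0\<close>: it comes from splitting \<open>s z + x y = 1 / (1 - s x)\<close>
    according to \<open>\<bar>x\<bar>\<^sup>2 + (1 - \<bar>x\<bar>\<^sup>2) = 1\<close>.\<close>
  define G :: "complex \<Rightarrow> complex ^ 4" where
    "G x = vector [s x, x, cnj x / (1 - s x * x), (1 + cmod x) / r / (1 - s x * x)]" for x
  have bound: "cmod (s x) < e" "1 - s x * x \<noteq> 0" if "cmod x \<le> 1" for x
  proof -
    have *: "cmod (s x) \<le> r"
      using that r unfolding s_def norm_of_real by (simp add: abs_mult mult_left_le)
    then show "cmod (s x) < e" using r by simp
    have "cmod (s x * x) \<le> r * 1"
      unfolding norm_mult using * that r by (intro mult_mono) auto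
    then show "1 - s x * x \<noteq> 0"
      using r by (metis eq_iff_diff_eq_0 leD mult.right_neutral norm_one)
  qed
  have FG: "F (G x) = vector [s x, 1]" if "cmod x \<le> 1" for x
  proof -
    have "s x * ((1 + cmod x) / r) + x * cnj x = 1"
      using r by (simp add: s_def complex_norm_square[symmetric] field_simps power2_eq_square
          flip: of_real_mult)
    moreover have "s x * ((1 + cmod x) / r / (1 - s x * x)) + x * (cnj x / (1 - s x * x))
        = (s x * ((1 + cmod x) / r) + x * cnj x) / (1 - s x * x)"
      by (metis add_divide_distrib times_divide_eq_right)
    ultimately have "(1 - s x * x) * (s x * ((1 + cmod x) / r / (1 - s x * x))
        + x * (cnj x / (1 - s x * x))) = 1"
      using bound(2)[OF that] by simp
    then show ?thesis
      by (simp add: vec_eq_iff forall_2 G_def vector_4)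
  qed
  have G: "G x \<in> F -` D" if "cmod x \<le> 1" for x
  proof -
    have "(vector [s x, 1] :: complex ^ 2) - t0 = axis 1 (s x)"
      by (simp add: t0_def vec_eq_iff forall_2 axis_def)
    then have "dist (vector [s x, 1]) t0 < e"
      using bound[OF that] by (simp add: dist_norm norm_vec_def L2_set_def sum_2 axis_def)
    then show ?thesis
      using FG[OF that] e by simp
  qed
  have contG: "continuous_on (cball 0 1) G"
  proof -
    have "continuous_on (cball 0 1) s"
      unfolding s_def[abs_def] by (intro continuous_intros)
    then have "continuous_on (cball 0 1) (\<lambda>x. G x $ i)" for i
      using exhaust_4[of i] r bound(2)
      by (elim disjE; simp only: G_def vector_4;
          intro continuous_on_divide continuous_on_mult continuous_on_diff continuous_on_add
            continuous_on_of_real continuous_on_norm continuous_on_cnj continuous_on_const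
            continuous_on_id; simp)
    then show ?thesis
      using continuous_on_vec_lambda[of "cball 0 1" "\<lambda>i x. G x $ i"] by simp
  qed
  \<comment> \<open>The disc is pushed into the fibre over \<open>t0\<close> by keeping the fibre
    component of the trivialisation and replacing the base component by \<open>t0\<close>.\<close>
  define H where "H x = \<Psi> (fst (\<Phi> (G x)), t0)" for x
  have \<Phi>G: "(fst (\<Phi> (G x)), t0) \<in> (F -` {t0}) \<times> D" if "cmod x \<le> 1" for x
  proof -
    have "\<Phi> (G x) \<in> (F -` {t0}) \<times> D"
      using bij_betwE[OF bij] G[OF that] by blast
    then show ?thesis
      using D by (simp add: mem_Times_iff)
  qed
  have FH: "F (H x) = t0" if "cmod x \<le> 1" for x
  proof -
    have "\<Phi> (H x) = (fst (\<Phi> (G x)), t0)"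
      unfolding H_def \<Psi>_def by (rule bij_betw_inv_into_right[OF bij \<Phi>G[OF that]])
    moreover have "H x \<in> F -` D"
      unfolding H_def \<Psi>_def using \<Phi>G[OF that] bij_betw_imp_surj_on[OF bij]
      by (intro inv_into_into) simp
    ultimately show ?thesis
      using proj[of "H x"] by simp
  qed
  have contH: "continuous_on (cball 0 1) H"
    unfolding H_def
    by (rule continuous_on_compose2[OF cont\<Psi>])
       (use \<Phi>G G in \<open>auto intro!: continuous_intros continuous_on_compose2[OF cont\<Phi> contG]\<close>)
  \<comment> \<open>Over \<open>t0\<close> the fibre equation reads \<open>x y = 1\<close>.\<close>
  have nz: "H x $ 2 \<noteq> 0" if "cmod x \<le> 1" for x
    using FH[OF that] by (auto simp: F_eq_iff t0_def)
  \<comment> \<open>On the boundary \<open>G x\<close> already lies over \<open>t0\<close>, so the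
    push leaves it fixed.\<close>
  have id: "H x $ 2 = x" if "cmod x = 1" for x
  proof -
    have "s x = 0" by (simp add: s_def that)
    then have "F (G x) = t0"
      using FG that by (simp add: t0_def)
    then have "\<Phi> (G x) = (fst (\<Phi> (G x)), t0)"
      using proj[OF G[of x]] that by (simp add: prod_eq_iff)
    then have "H x = G x"
      using bij_betw_inv_into_left[OF bij G] that by (simp add: H_def \<Psi>_def)
    then show ?thesis by (simp add: G_def vector_4)
  qed
  have "retraction (cball 0 1) (sphere 0 1) (\<lambda>x. sgn (H x $ 2))"
    unfolding retraction_def using nz id
    by (auto simp: norm_divide sgn_eq intro!: continuous_intros contH)
  then show False
    using no_retraction_cball[of 1 "0 :: complex"] by (auto simp: retract_of_def)
qed

theorem theorem3p1:
  shows "\<exists>(F :: complex ^ 4 \<Rightarrow> complex ^ 2) (t0 :: complex ^ 2).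
           polynomial_map F \<and>
           t0 \<in> interior (range F - F ` Sing F) \<and>
           (\<exists>D. open D \<and> t0 \<in> D \<and>
              (\<forall>t\<in>D. connected (F -` {t})) \<and>
              (\<forall>s\<in>D. \<forall>t\<in>D. diffeomorphic (F -` {s}) (F -` {t}))) \<and>
           t0 \<in> bifurcation_values F"
proof (intro exI conjI)
  \<comment> \<open>One large neighbourhood serves both the interior claim and the claims about the
    fibres.\<close>
  let ?D = "{t :: complex ^ 2. t $ 2 \<noteq> 0}"
  let ?t0 = "vector [0, 1] :: complex ^ 2"
  show "polynomial_map F"
    by (rule polynomial_map_F)
  show D: "open ?D"
    by (intro open_Collect_neq continuous_intros)
  show t0: "?t0 \<in> ?D"
    by simp
  \<comment> \<open>The point with coordinates \<open>u = 1\<close>, \<open>v = 0\<close> lies over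
    \<open>t\<close>.\<close>
  have "t \<in> range F" for t
    using F_fibre_point[of 1 t 0] by (metis rangeI zero_neq_one)
  then have "?D \<subseteq> range F - F ` Sing F"
    using submersion_at_F by (auto simp: Sing_def)
  then show "?t0 \<in> interior (range F - F ` Sing F)"
    using D t0 by (meson interiorI)
  show "\<forall>t\<in>?D. connected (F -` {t})"
    using connected_fibre by simp
  show "\<forall>s\<in>?D. \<forall>t\<in>?D. diffeomorphic (F -` {s}) (F -` {t})"
    using diffeomorphic_fibres by simp
  show "?t0 \<in> bifurcation_values F"
    using not_smoothly_trivial_at_F by (simp add: bifurcation_values_def)
qed

end
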